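(* Fix $\delta\in(1/2,1]$, $\alpha_0>0$, $0\le\beta<\delta-1/2$ and $c>0$. There is a class of processes, each satisfying the projected stochastic approximation recursion with an adaptive Markov chain and all of the step-size (with this $\alpha_0$ and $\delta$), compactness, ergodicity, kernel-continuity, growth, interior-target and quasi-strong-monotonicity conditions of the context, together with $2\zeta\alpha_0>1$ when $\delta=1$, and all sharing common numerical values of the constants $N,\epsilon_0,\lambda,b,L_P,L_F,C_F,\zeta$ in those conditions, with the following property. For each $\epsilon>0$, some process in this class satisfies $$\mathbb P\Bigl(\exists\,k\ge k_0:\ \|\theta_k-\theta^\star\|>c\,k^{-\beta}\,\Bigm|\,\mathcal F_0\Bigr)\ \ge\ C_\epsilon\,k_0^{-(2(\delta-\beta)-1+\epsilon)}\qquad\text{for all }k_0\ge K_\epsilon,$$ where $C_\epsilon$ and $K_\epsilon$ are some positive constants.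
   Context: Setting. $\|\cdot\|$ is the Euclidean norm and $\langle\cdot,\cdot\rangle$ the Euclidean inner product. A process consists of a set $\Theta\subseteq\mathbb R^d$, a Borel subset $\mathcal W$ of a Euclidean space, a jointly Borel measurable $F:\Theta\times\mathcal W\to\mathbb R^d$, a family $\{P_\theta:\theta\in\Theta\}$ of Markov transition kernels on $\mathcal W$ with $(\theta,w)\mapsto P_\theta(w,E)$ Borel measurable for each Borel $E$, an initial $\Theta\times\mathcal W$-valued random element $(\theta_0,W_0)$, and random sequences with $$\theta_{k+1}=\Pi_\Theta\bigl(\theta_k+\alpha_kF(\theta_k,W_k)\bigr),\qquad \mathbb P(W_{k+1}\in E\mid\mathcal F_k)=P_{\theta_k}(W_k,E)$$ for all $k\ge0$ and Borel $E$, where $\Pi_\Theta$ is Euclidean projection onto $\Theta$ and $\mathcal F_k:=\sigma(\theta_0,W_0,\dots,\theta_k,W_k)$. Write $(P_\theta f)(w):=\int f(y)P_\theta(w,dy)$, $P_\theta^k$ for the $k$-step kernel, and $U_p(w):=1+\|w\|^p$ for $p\in\{1,2\}$. (In)equalities between random quantities hold almost surely. Constants are deterministic and do not depend on the realization of $(\theta_0,W_0)$. Conditions. - Step sizes: $\alpha_k=\alpha_0k^{-\delta}$ for all $k\ge1$ (the step size at $k=0$ is $\alpha_0$). - Compactness: $\Theta$ is nonempty, compact and convex. - Ergodicity: (i) each $P_\theta$ is irreducible and aperiodic (as a general-state-space chain); there are a positive integer $N$, a nonempty Borel set $\mathcal W_0\subseteq\mathcal W$, $\epsilon_0>0$ and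 a probability measure $\varphi$ on $\mathcal W$ with $P_\theta^N(w,E)\ge\epsilon_0\varphi(E)$ for all $\theta\in\Theta$, $w\in\mathcal W_0$ and Borel $E$; and there are constants $0\le\lambda<1$, $b\ge0$ with $(P_\theta U_2)(w)\le\lambda U_2(w)+b\,\mathbb I_{\mathcal W_0}(w)$ for all $\theta\in\Theta$, $w\in\mathcal W$. (ii) $\mathbb E[U_2(W_0)]<\infty$. Part (i) ensures that each $P_\theta$ has a unique stationary distribution $\nu_\theta$ with $\nu_\theta(U_2)<\infty$; set $\bar F(\theta):=\int_{\mathcal W}F(\theta,w)\,\nu_\theta(dw)$. - Kernel continuity: $L_P>0$ and $|(P_\theta f)(w)-(P_{\theta'}f)(w)|\le L_PU_1(w)\|\theta-\theta'\|$ for all $\theta,\theta'\in\Theta$, $w\in\mathcal W$ and Borel $f:\mathcal W\to\mathbb R$ with $|f|\le U_1$. - Growth: $L_F,C_F>0$ and $\|F(\theta,w)-F(\theta',w)\|\le L_F(1+\|w\|)\|\theta-\theta'\|$, $\sup_{\theta\in\Theta}\|F(\theta,w)\|\le C_F(1+\|w\|)$ for all $\theta,\theta'\in\Theta$, $w\in\mathcal W$. - Interior target: there is $\theta^\star\in\operatorname{int}(\Theta)$ with $\bar F(\theta^\star)=0$. - Quasi-strong monotonicity: $\zeta>0$ and $\langle\theta-\theta^\star,\bar F(\theta)\rangle\le-\zeta\|\theta-\theta^\star\|^2$ for all $\theta\in\Theta$. *)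

theory Defs
  imports "HOL-Probability.Probability"
begin

section \<open>Euclidean spaces of varying dimension\<close>

text \<open>
  The dimensions of the parameter space and of the state space are part of the data of a process,
  so they have to be bound inside a formula.  The Euclidean space of dimension \<open>d\<close> is therefore
  \<^term>\<open>Euclidean_space d\<close>, whose points are the real sequences vanishing at all indices \<open>i \<ge> d\<close>,
  and its norm is the \<^const>\<open>L2_set\<close> norm over the first \<open>d\<close> coordinates.  Its topology is the
  subspace topology of the product topology, i.e. of the topology of the type
  \<^typ>\<open>nat \<Rightarrow> real\<close>; its Borel sets are hence the members of \<^const>\<open>borel\<close> contained in it.
  The metric of the type \<^typ>\<open>nat \<Rightarrow> real\<close> is not the Euclidean one, so \<^const>\<open>dist\<close> and
  \<^const>\<open>closest_point\<close> are not usable here.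
\<close>

type_synonym vec = "nat \<Rightarrow> real"

abbreviation Rn :: "nat \<Rightarrow> vec set" where
  "Rn d \<equiv> topspace (Euclidean_space d)"

definition enorm :: "nat \<Rightarrow> vec \<Rightarrow> real" where
  "enorm d x = L2_set x {..<d}"

definition edist :: "nat \<Rightarrow> vec \<Rightarrow> vec \<Rightarrow> real" where
  "edist d x y = enorm d (\<lambda>i. x i - y i)"

definition einner :: "nat \<Rightarrow> vec \<Rightarrow> vec \<Rightarrow> real" where
  "einner d x y = (\<Sum>i<d. x i * y i)"

definition econvex :: "vec set \<Rightarrow> bool" where
  "econvex S \<longleftrightarrow>
     (\<forall>x\<in>S. \<forall>y\<in>S. \<forall>u\<ge>0. \<forall>v\<ge>0. u + v = 1 \<longrightarrow> (\<lambda>i. u * x i + v * y i) \<in> S)"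

definition eproj :: "nat \<Rightarrow> vec set \<Rightarrow> vec \<Rightarrow> vec" where
  "eproj d S a = (SOME x. x \<in> S \<and> (\<forall>y\<in>S. edist d a x \<le> edist d a y))"

section \<open>Markov kernels on a general state space\<close>

text \<open>
  A kernel on a measurable space \<open>S\<close> (only the \<open>\<sigma>\<close>-algebra of \<open>S\<close> matters) is a function
  \<open>K \<in> S \<rightarrow>\<^sub>M prob_algebra S\<close>.
\<close>

primrec kstep :: "'a measure \<Rightarrow> ('a \<Rightarrow> 'a measure) \<Rightarrow> nat \<Rightarrow> 'a \<Rightarrow> 'a measure" where
  "kstep S K 0 w = return S w"
| "kstep S K (Suc n) w = bind (kstep S K n w) K"

text \<open>
  Irreducibility and aperiodicity are taken in the sense of Meyn and Tweedie: the existence of a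
  nontrivial irreducibility measure, respectively the absence of cycles of length greater than one
  covering the space up to a null set of a maximal irreducibility measure.
\<close>

definition irreducibility_measure :: "'a measure \<Rightarrow> ('a \<Rightarrow> 'a measure) \<Rightarrow> 'a measure \<Rightarrow> bool" where
  "irreducibility_measure S K \<phi> \<longleftrightarrow>
     sets \<phi> = sets S \<and> sigma_finite_measure \<phi> \<and> emeasure \<phi> (space S) \<noteq> 0 \<and>
     (\<forall>E\<in>sets S. emeasure \<phi> E > 0 \<longrightarrow>
        (\<forall>w\<in>space S. \<exists>n>0. measure (kstep S K n w) E > 0))"

definition irreducible_kernel :: "'a measure \<Rightarrow> ('a \<Rightarrow> 'a measure) \<Rightarrow> bool" where
  "irreducible_kernel S K \<longleftrightarrow> (\<exists>\<phi>. irreducibility_measure S K \<phi>)"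

definition maximal_irreducibility_measure ::
    "'a measure \<Rightarrow> ('a \<Rightarrow> 'a measure) \<Rightarrow> 'a measure \<Rightarrow> bool" where
  "maximal_irreducibility_measure S K \<psi> \<longleftrightarrow>
     irreducibility_measure S K \<psi> \<and>
     (\<forall>\<phi>. irreducibility_measure S K \<phi> \<longrightarrow> absolutely_continuous \<psi> \<phi>)"

definition kernel_cycle ::
    "'a measure \<Rightarrow> ('a \<Rightarrow> 'a measure) \<Rightarrow> 'a measure \<Rightarrow> nat \<Rightarrow> (nat \<Rightarrow> 'a set) \<Rightarrow> bool" where
  "kernel_cycle S K \<psi> p D \<longleftrightarrow>
     p > 0 \<and> (\<forall>i<p. D i \<in> sets S) \<and> disjoint_family_on D {..<p} \<and>
     (\<forall>i<p. \<forall>w\<in>D i. measure (K w) (D (Suc i mod p)) = 1) \<and>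
     emeasure \<psi> (space S - (\<Union>i<p. D i)) = 0"

text \<open>
  A maximal irreducibility measure is unique up to equivalence of measures, so the choice of
  \<open>\<psi>\<close> in the following definition is immaterial.
\<close>

definition aperiodic_kernel :: "'a measure \<Rightarrow> ('a \<Rightarrow> 'a measure) \<Rightarrow> bool" where
  "aperiodic_kernel S K \<longleftrightarrow>
     (\<exists>\<psi>. maximal_irreducibility_measure S K \<psi> \<and> (\<forall>p D. kernel_cycle S K \<psi> p D \<longrightarrow> p = 1))"

definition stationary :: "'a measure \<Rightarrow> ('a \<Rightarrow> 'a measure) \<Rightarrow> 'a measure \<Rightarrow> bool" where
  "stationary S K \<nu> \<longleftrightarrow> \<nu> \<in> space (prob_algebra S) \<and> bind \<nu> K = \<nu>"

section \<open>Projected stochastic approximation with an adaptive Markov chain\<close>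

text \<open>
  The sample space is a set of paths.  This loses no generality, since the joint law of the
  sequences \<open>(\<theta>\<^sub>k)\<close> and \<open>(W\<^sub>k)\<close> can be realized by the coordinate maps on the path space, and all
  conditions and conclusions depend on that law only.
\<close>

type_synonym path = "nat \<Rightarrow> vec \<times> vec"

record sa_process =
  pdim :: nat
  wdim :: nat
  params :: "vec set"
  states :: "vec set"
  field_F :: "vec \<Rightarrow> vec \<Rightarrow> vec"
  kern :: "vec \<Rightarrow> vec \<Rightarrow> vec measure"
  sample :: "path measure"
  theta :: "nat \<Rightarrow> path \<Rightarrow> vec"
  chain :: "nat \<Rightarrow> path \<Rightarrow> vec"
  target :: vec

definition wspace :: "sa_process \<Rightarrow> vec measure" where
  "wspace p = restrict_space borel (states p)"

definition U :: "sa_process \<Rightarrow> nat \<Rightarrow> vec \<Rightarrow> real" where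
  "U p q w = 1 + enorm (wdim p) w ^ q"

definition history :: "sa_process \<Rightarrow> nat \<Rightarrow> path measure" where
  "history p k = sigma (space (sample p))
     {(\<lambda>\<omega>. (theta p j \<omega>, chain p j \<omega>)) -` A \<inter> space (sample p) | j A.
        j \<le> k \<and> A \<in> sets (borel :: (vec \<times> vec) measure)}"

definition stat_dist :: "sa_process \<Rightarrow> vec \<Rightarrow> vec measure" where
  "stat_dist p \<theta> = (THE \<nu>. stationary (wspace p) (kern p \<theta>) \<nu>)"

definition mean_field :: "sa_process \<Rightarrow> vec \<Rightarrow> vec" where
  "mean_field p \<theta> = (\<lambda>i. \<integral>w. field_F p \<theta> w i \<partial>stat_dist p \<theta>)"

definition step_size :: "real \<Rightarrow> real \<Rightarrow> nat \<Rightarrow> real" where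
  "step_size \<alpha>0 \<delta> k = (if k = 0 then \<alpha>0 else \<alpha>0 * real k powr (-\<delta>))"

text \<open>
  Since \<^const>\<open>prob_algebra\<close> carries the \<open>\<sigma>\<close>-algebra generated by the evaluations at measurable sets,
  the measurability of \<open>kern p\<close> below says that each \<open>kern p \<theta> w\<close> is a probability measure on the
  Borel sets of the state space and that \<open>(\<theta>, w) \<mapsto> kern p \<theta> w E\<close> is Borel for each of them.
\<close>

definition sa_model :: "sa_process \<Rightarrow> bool" where
  "sa_model p \<longleftrightarrow>
     pdim p > 0 \<and> params p \<subseteq> Rn (pdim p) \<and>
     states p \<subseteq> Rn (wdim p) \<and> states p \<in> sets borel \<and>
     (\<forall>\<theta>\<in>params p. \<forall>w\<in>states p. field_F p \<theta> w \<in> Rn (pdim p)) \<and>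
     (\<lambda>(\<theta>, w). field_F p \<theta> w) \<in> borel_measurable (restrict_space borel (params p \<times> states p)) \<and>
     (\<lambda>(\<theta>, w). kern p \<theta> w)
        \<in> restrict_space borel (params p \<times> states p) \<rightarrow>\<^sub>M prob_algebra (wspace p)"

definition sa_recursion :: "real \<Rightarrow> real \<Rightarrow> sa_process \<Rightarrow> bool" where
  "sa_recursion \<alpha>0 \<delta> p \<longleftrightarrow>
     prob_space (sample p) \<and>
     (\<forall>k. theta p k \<in> sample p \<rightarrow>\<^sub>M restrict_space borel (params p)) \<and>
     (\<forall>k. chain p k \<in> sample p \<rightarrow>\<^sub>M wspace p) \<and>
     (\<forall>k. AE \<omega> in sample p.
        theta p (Suc k) \<omega> =
          eproj (pdim p) (params p)
            (\<lambda>i. theta p k \<omega> i + step_size \<alpha>0 \<delta> k * field_F p (theta p k \<omega>) (chain p k \<omega>) i)) \<and>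
     (\<forall>k. \<forall>E\<in>sets (wspace p). AE \<omega> in sample p.
        real_cond_exp (sample p) (history p k) (indicator {\<omega> \<in> space (sample p). chain p (Suc k) \<omega> \<in> E}) \<omega>
          = measure (kern p (theta p k \<omega>) (chain p k \<omega>)) E)"

definition compactness :: "sa_process \<Rightarrow> bool" where
  "compactness p \<longleftrightarrow>
     params p \<noteq> {} \<and> compactin (Euclidean_space (pdim p)) (params p) \<and> econvex (params p)"

definition ergodicity :: "nat \<Rightarrow> real \<Rightarrow> real \<Rightarrow> real \<Rightarrow> sa_process \<Rightarrow> bool" where
  "ergodicity N \<epsilon>0 l b p \<longleftrightarrow>
     (\<forall>\<theta>\<in>params p. irreducible_kernel (wspace p) (kern p \<theta>) \<and> aperiodic_kernel (wspace p) (kern p \<theta>)) \<and>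
     N > 0 \<and> \<epsilon>0 > 0 \<and> 0 \<le> l \<and> l < 1 \<and> 0 \<le> b \<and>
     (\<exists>W0 \<phi>. W0 \<in> sets (wspace p) \<and> W0 \<noteq> {} \<and> \<phi> \<in> space (prob_algebra (wspace p)) \<and>
        (\<forall>\<theta>\<in>params p. \<forall>w\<in>W0. \<forall>E\<in>sets (wspace p).
           measure (kstep (wspace p) (kern p \<theta>) N w) E \<ge> \<epsilon>0 * measure \<phi> E) \<and>
        (\<forall>\<theta>\<in>params p. \<forall>w\<in>states p.
           (\<integral>\<^sup>+ y. ennreal (U p 2 y) \<partial>kern p \<theta> w) \<le> ennreal (l * U p 2 w + b * indicator W0 w))) \<and>
     integrable (sample p) (\<lambda>\<omega>. U p 2 (chain p 0 \<omega>))"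

definition kernel_continuity :: "real \<Rightarrow> sa_process \<Rightarrow> bool" where
  "kernel_continuity LP p \<longleftrightarrow>
     LP > 0 \<and>
     (\<forall>\<theta>\<in>params p. \<forall>\<theta>'\<in>params p. \<forall>w\<in>states p. \<forall>f\<in>borel_measurable (wspace p).
        (\<forall>y\<in>states p. \<bar>f y\<bar> \<le> U p 1 y) \<longrightarrow>
        \<bar>(\<integral>y. f y \<partial>kern p \<theta> w) - (\<integral>y. f y \<partial>kern p \<theta>' w)\<bar> \<le> LP * U p 1 w * edist (pdim p) \<theta> \<theta>')"

definition growth :: "real \<Rightarrow> real \<Rightarrow> sa_process \<Rightarrow> bool" where
  "growth LF CF p \<longleftrightarrow>
     LF > 0 \<and> CF > 0 \<and>
     (\<forall>\<theta>\<in>params p. \<forall>\<theta>'\<in>params p. \<forall>w\<in>states p.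
        edist (pdim p) (field_F p \<theta> w) (field_F p \<theta>' w)
          \<le> LF * (1 + enorm (wdim p) w) * edist (pdim p) \<theta> \<theta>') \<and>
     (\<forall>\<theta>\<in>params p. \<forall>w\<in>states p.
        enorm (pdim p) (field_F p \<theta> w) \<le> CF * (1 + enorm (wdim p) w))"

definition interior_target :: "sa_process \<Rightarrow> bool" where
  "interior_target p \<longleftrightarrow>
     target p \<in> Euclidean_space (pdim p) interior_of params p \<and>
     mean_field p (target p) = (\<lambda>i. 0)"

definition quasi_strong_monotonicity :: "real \<Rightarrow> sa_process \<Rightarrow> bool" where
  "quasi_strong_monotonicity \<zeta> p \<longleftrightarrow>
     \<zeta> > 0 \<and>
     (\<forall>\<theta>\<in>params p.
        einner (pdim p) (\<lambda>i. \<theta> i - target p i) (mean_field p \<theta>)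
          \<le> - \<zeta> * (edist (pdim p) \<theta> (target p))\<^sup>2)"

definition sa_conditions ::
    "real \<Rightarrow> real \<Rightarrow> nat \<Rightarrow> real \<Rightarrow> real \<Rightarrow> real \<Rightarrow> real \<Rightarrow> real \<Rightarrow> real \<Rightarrow> real \<Rightarrow> sa_process \<Rightarrow> bool" where
  "sa_conditions \<alpha>0 \<delta> N \<epsilon>0 l b LP LF CF \<zeta> p \<longleftrightarrow>
     sa_model p \<and> sa_recursion \<alpha>0 \<delta> p \<and> compactness p \<and> ergodicity N \<epsilon>0 l b p \<and>
     kernel_continuity LP p \<and> growth LF CF p \<and> interior_target p \<and>
     quasi_strong_monotonicity \<zeta> p \<and> (\<delta> = 1 \<longrightarrow> 2 * \<zeta> * \<alpha>0 > 1)"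

definition exit_event :: "sa_process \<Rightarrow> real \<Rightarrow> real \<Rightarrow> nat \<Rightarrow> path set" where
  "exit_event p c \<beta> k0 =
     {\<omega> \<in> space (sample p).
        \<exists>k\<ge>k0. edist (pdim p) (theta p k \<omega>) (target p) > c * real k powr (-\<beta>)}"

end

theory Submission
  imports Defs
begin

text \<open>
  The polynomial rate is forced by a single large noise value.  The processes are one-dimensional:
  the chain is an independent sequence with a law whose second moment is \<open>1\<close> and whose tail is at
  least of order \<open>t powr (-(2 + \<epsilon>))\<close>, the parameter set is \<open>[-2 * c, 2 * c]\<close>, and the field is
  \<open>- x / \<alpha>0 + (w - m)\<close> with \<open>m\<close> the mean of the noise, so that the target is \<open>0\<close> and the mean field
  is \<open>- x / \<alpha>0\<close>.  As the kernel does not depend on the parameter or on the current state, ergodicity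
  and kernel continuity are immediate, and the only constant which could vary with the tail exponent is
  the bound on the second moment.  The law is normalized so that it does not
  (\<open>heavy_tailed_law\<close>); hence all these processes share their constants.

  A noise value of size at least a constant times \<open>k powr (\<delta> - \<beta>)\<close> moves the iterate by at least
  \<open>3 * c * k powr (-\<beta>)\<close>, since the step size is \<open>\<alpha>0 * k powr (-\<delta>)\<close>.  Either the iterate was already
  outside the radius \<open>c * k powr (-\<beta>)\<close>, or it is outside after the jump (\<open>jump_exits\<close>).  So the exit
  event contains the event that one of the \<open>k0\<close> noise values at the times \<open>k0, ..., 2 * k0 - 1\<close> is that
  large.  This event is independent of the initial values, and its probability is at least of the order of
  \<open>k0 * (k0 powr (\<delta> - \<beta>)) powr (-(2 + \<epsilon>))\<close>, which is in turn at least of the order of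
  \<open>k0 powr (-(2 * (\<delta> - \<beta>) - 1 + \<epsilon>))\<close> (\<open>polynomial_cond_exit_prob\<close>).
\<close>

section \<open>Heavy-tailed laws with unit second moment\<close>

text \<open>
  A geometric variable \<open>n\<close> with ratio \<open>q = 2 powr (-(2 + \<eta>))\<close> makes \<open>2 ^ n\<close> exceed \<open>t\<close> with
  probability of order \<open>t powr (-(2 + \<eta>))\<close>, and its second moment is a geometric series of ratio
  \<open>4 * q < 1\<close>.  Rescaling by \<open>s\<close> makes that moment equal to \<open>1\<close> whatever \<open>\<eta>\<close> is; this is what lets
  one drift bound serve all tail exponents.
\<close>

lemma heavy_tailed_law:
  fixes \<eta> :: real
  assumes "\<eta> > 0"
  obtains D :: "real measure" and \<kappa> :: real
  where "prob_space D" "sets D = sets borel" "integrable D (\<lambda>x. x\<^sup>2)" "(\<integral>x. x\<^sup>2 \<partial>D) = 1"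
    "\<kappa> > 0" "\<And>t. t \<ge> 1 \<Longrightarrow> measure D {t..} \<ge> \<kappa> * t powr (-(2 + \<eta>))"
proof -
  define q where "q = 2 powr (-(2 + \<eta>))"
  define s where "s = sqrt ((1 - 4 * q) / (1 - q))"
  define X where "X = (\<lambda>n::nat. s * 2 ^ n)"
  define G where "G = measure_pmf (geometric_pmf (1 - q))"
  define D where "D = distr G borel X"
  have "q < 2 powr (-2)"
    unfolding q_def using assms by (intro powr_less_mono) auto
  then have q: "0 < q" "4 * q < 1" "q < 1"
    by (auto simp: q_def powr_minus powr_numeral)
  have s2: "s\<^sup>2 = (1 - 4 * q) / (1 - q)" and s: "0 < s" "s \<le> 1"
    using q by (auto simp: s_def)
  have pmf: "pmf (geometric_pmf (1 - q)) n = q ^ n * (1 - q)" for n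
    using q by (subst pmf_geometric) auto
  have X: "X \<in> G \<rightarrow>\<^sub>M borel"
    by (simp add: G_def)
  interpret D: prob_space D
    unfolding D_def G_def by (intro prob_space.prob_space_distr measure_pmf.prob_space_axioms) simp
  have "(\<lambda>n. (1 - 4 * q) * (4 * q) ^ n) sums ((1 - 4 * q) * (1 / (1 - 4 * q)))"
    using q by (intro sums_mult geometric_sums) auto
  then have sums: "(\<lambda>n. (1 - 4 * q) * (4 * q) ^ n) sums 1"
    using q by simp
  have term_eq: "(q ^ n * (1 - q)) * (X n)\<^sup>2 = (1 - 4 * q) * (4 * q) ^ n" for n
  proof -
    have "(X n)\<^sup>2 = s\<^sup>2 * 4 ^ n"
      by (simp add: X_def power_mult_distrib) (simp add: power2_eq_square flip: power_mult_distrib)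
    then show ?thesis
      using q by (simp add: s2 power_mult_distrib)
  qed
  have "(\<integral>\<^sup>+x. ennreal (x\<^sup>2) \<partial>D) = (\<integral>\<^sup>+n. ennreal ((X n)\<^sup>2) \<partial>G)"
    unfolding D_def using X by (subst nn_integral_distr) auto
  also have "\<dots> = (\<Sum>n. ennreal ((1 - 4 * q) * (4 * q) ^ n))"
    unfolding G_def nn_integral_measure_pmf nn_integral_count_space_nat pmf
    by (simp only: ennreal_mult''[symmetric] zero_le_power2 term_eq)
  also have "\<dots> = ennreal 1"
    using q by (intro suminf_ennreal_eq sums) auto
  finally have nn: "(\<integral>\<^sup>+x. ennreal (x\<^sup>2) \<partial>D) = ennreal 1" .
  have meas: "(\<lambda>x. x\<^sup>2) \<in> borel_measurable D"
    by (simp add: D_def)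
  have int: "integrable D (\<lambda>x. x\<^sup>2)"
    by (rule integrableI_nn_integral_finite[OF meas _ nn]) auto
  have one: "(\<integral>x. x\<^sup>2 \<partial>D) = 1"
    by (subst integral_eq_nn_integral[OF meas]) (auto simp: nn)
  have tail: "measure D {t..} \<ge> ((1 - q) * q * s powr (2 + \<eta>)) * t powr (-(2 + \<eta>))" if t: "t \<ge> 1" for t
  proof -
    \<comment> \<open>The least index whose atom \<open>X n\<close> lies in the tail; its mass alone is large enough.\<close>
    define n where "n = nat \<lceil>log 2 (t / s)\<rceil>"
    have ts: "t / s \<ge> 1"
      using s t by simp
    then have "real n = of_int \<lceil>log 2 (t / s)\<rceil>"
      by (simp add: n_def)
    then have n: "log 2 (t / s) \<le> n" "n \<le> log 2 (t / s) + 1"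
      by linarith+
    have "t / s = 2 powr (log 2 (t / s))"
      using ts by simp
    also have "\<dots> \<le> 2 powr n"
      using n by (intro powr_mono) auto
    finally have "t \<le> X n"
      using s by (simp add: X_def powr_realpow field_simps)
    have "q * (t / s) powr (-(2 + \<eta>)) = q * (2 powr log 2 (t / s)) powr (-(2 + \<eta>))"
      using ts by simp
    also have "\<dots> = 2 powr (-(2 + \<eta>) + log 2 (t / s) * (-(2 + \<eta>)))"
      unfolding q_def powr_powr powr_add[symmetric] ..
    also have "\<dots> = 2 powr (-(2 + \<eta>) * (log 2 (t / s) + 1))"
      by (simp add: algebra_simps)
    also have "\<dots> \<le> 2 powr (-(2 + \<eta>) * n)"
      using n assms by (intro powr_mono mult_left_mono_neg) auto
    also have "\<dots> = q ^ n"
      by (simp add: q_def flip: powr_powr powr_realpow)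
    finally have "q * (t / s) powr (-(2 + \<eta>)) \<le> q ^ n" .
    then have "(1 - q) * (q * (t / s) powr (-(2 + \<eta>))) \<le> (1 - q) * q ^ n"
      using q by (intro mult_left_mono) auto
    moreover have div: "(t / s) powr (-r) = s powr r * t powr (-r)" for r
      using s t by (simp add: powr_divide powr_minus field_simps)
    ultimately have "((1 - q) * q * s powr (2 + \<eta>)) * t powr (-(2 + \<eta>)) \<le> (1 - q) * q ^ n"
      by (simp only: div mult.assoc)
    also have "\<dots> = measure G {n}"
      unfolding G_def by (simp only: measure_pmf_single pmf mult.commute)
    also have "\<dots> \<le> measure G (X -` {t..} \<inter> space G)"
      unfolding G_def using \<open>t \<le> X n\<close> by (intro measure_pmf.finite_measure_mono) auto
    also have "\<dots> = measure D {t..}"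
      unfolding D_def using X by (subst measure_distr) auto
    finally show ?thesis .
  qed
  show ?thesis
    by (rule that[OF D.prob_space_axioms _ int one _ tail]) (use q s in \<open>auto simp: D_def\<close>)
qed

section \<open>The Euclidean space of dimension one\<close>

definition embed :: "real \<Rightarrow> vec" where
  "embed r = (\<lambda>i. if i = 0 then r else 0)"

lemma embed_0 [simp]: "embed r 0 = r"
  by (simp add: embed_def)

lemma embed_eq_iff [simp]: "embed r = embed s \<longleftrightarrow> r = s"
  by (metis embed_0)

lemma Rn_1: "Rn (Suc 0) = range embed"
proof (intro set_eqI iffI)
  fix x assume "x \<in> Rn (Suc 0)"
  then have "x = embed (x 0)"
    by (auto simp: topspace_Euclidean_space embed_def fun_eq_iff Suc_le_eq)
  then show "x \<in> range embed" by blast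
qed (auto simp: topspace_Euclidean_space embed_def)

lemma embed_in_Rn [simp]: "embed r \<in> Rn (Suc 0)"
  by (simp add: Rn_1)

lemma enorm_1 [simp]: "enorm (Suc 0) x = \<bar>x 0\<bar>"
  by (simp add: enorm_def L2_set_def lessThan_Suc)

lemma edist_1 [simp]: "edist (Suc 0) x y = \<bar>x 0 - y 0\<bar>"
  by (simp add: edist_def)

lemma einner_1 [simp]: "einner (Suc 0) x y = x 0 * y 0"
  by (simp add: einner_def)

lemma continuous_on_embed: "continuous_on A embed"
proof -
  have "continuous_on A (\<lambda>r. if i = 0 then r else 0 :: real)" for i :: nat
    by (cases "i = 0") auto
  then show ?thesis
    unfolding embed_def by (intro continuous_on_coordinatewise_then_product)
qed

lemma borel_measurable_embed [measurable]: "embed \<in> borel_measurable borel"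
  by (intro borel_measurable_continuous_onI continuous_on_embed)

lemma borel_measurable_coord [measurable]: "(\<lambda>x::vec. x i) \<in> borel_measurable borel"
  by (intro borel_measurable_continuous_onI) auto

lemma Rn_borel [measurable]: "Rn d \<in> sets borel"
proof -
  have "closed (\<Inter>i\<in>{d..}. {x::vec. x i = 0})"
    by (intro closed_INT ballI closed_Collect_eq) auto
  then have "(\<Inter>i\<in>{d..}. {x::vec. x i = 0}) \<in> sets borel" by (rule borel_closed)
  also have "(\<Inter>i\<in>{d..}. {x::vec. x i = 0}) = Rn d"
    by (auto simp: topspace_Euclidean_space)
  finally show ?thesis .
qed

lemma Euclidean_space_1: "Euclidean_space (Suc 0) = top_of_set (range embed)"
  using Rn_1 by (simp add: Euclidean_space_def euclidean_product_topology)

lemma compactin_embed_interval: "compactin (Euclidean_space (Suc 0)) (embed ` {a..b})"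
  unfolding Euclidean_space_1 compactin_subtopology
  by (auto intro!: compact_continuous_image continuous_on_embed)

lemma econvex_embed_interval: "econvex (embed ` {a..b})"
  unfolding econvex_def
proof (intro ballI allI impI)
  fix x y and u v :: real
  assume "x \<in> embed ` {a..b}" "y \<in> embed ` {a..b}" and uv: "0 \<le> u" "0 \<le> v" "u + v = 1"
  then obtain r s where rs: "x = embed r" "y = embed s" "r \<in> {a..b}" "s \<in> {a..b}"
    by blast
  then have "u * r + v * s \<in> {a..b}"
    using convexD[OF convex_real_interval(5), of r a b s u v] uv by simp
  moreover have "(\<lambda>i. u * x i + v * y i) = embed (u * r + v * s)"
    by (auto simp: rs embed_def fun_eq_iff)
  ultimately show "(\<lambda>i. u * x i + v * y i) \<in> embed ` {a..b}"
    by blast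
qed

lemma interior_embed_interval:
  assumes "a < r" "r < b"
  shows "embed r \<in> Euclidean_space (Suc 0) interior_of embed ` {a..b}"
  unfolding interior_of_def
proof (intro CollectI exI conjI)
  let ?T = "range embed \<inter> (\<lambda>x. x 0) -` {a<..<b}"
  have "open ((\<lambda>x::vec. x 0) -` {a<..<b})"
    by (intro open_vimage) auto
  then show "openin (Euclidean_space (Suc 0)) ?T"
    unfolding Euclidean_space_1 by (rule openin_open_Int)
  show "embed r \<in> ?T" using assms by simp
  show "?T \<subseteq> embed ` {a..b}" by auto
qed

definition clip :: "real \<Rightarrow> real \<Rightarrow> real" where
  "clip R x = max (- R) (min R x)"

text \<open>
  The distance to a point of the line sees only the coordinate of index \<open>0\<close>, so the point \<open>a\<close> to be
  projected may have arbitrary further coordinates.  Since \<^const>\<open>eproj\<close> is a choice, the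
  uniqueness of the nearest point is needed to evaluate it.
\<close>

lemma eproj_embed_interval:
  assumes "R \<ge> 0"
  shows "eproj (Suc 0) (embed ` {-R..R}) a = embed (clip R (a 0))"
  unfolding eproj_def
proof (rule some_equality)
  have "clip R (a 0) \<in> {-R..R}" using assms by (auto simp: clip_def)
  moreover have "\<bar>a 0 - clip R (a 0)\<bar> \<le> \<bar>a 0 - r\<bar>" if "r \<in> {-R..R}" for r
    using that by (auto simp: clip_def max_def min_def)
  ultimately show "embed (clip R (a 0)) \<in> embed ` {-R..R} \<and>
      (\<forall>y\<in>embed ` {-R..R}. edist (Suc 0) a (embed (clip R (a 0))) \<le> edist (Suc 0) a y)"
    by auto
next
  fix x assume x: "x \<in> embed ` {-R..R} \<and> (\<forall>y\<in>embed ` {-R..R}. edist (Suc 0) a x \<le> edist (Suc 0) a y)"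
  then obtain r where r: "x = embed r" "-R \<le> r" "r \<le> R" by auto
  have "clip R (a 0) \<in> {-R..R}" using assms by (auto simp: clip_def)
  then have "\<bar>a 0 - r\<bar> \<le> \<bar>a 0 - clip R (a 0)\<bar>"
    using x r by (auto simp: ball_def)
  then have "r = clip R (a 0)"
    using r by (auto simp: clip_def max_def min_def split: if_splits)
  then show "x = embed (clip R (a 0))" using r by simp
qed

section \<open>Independent coordinates in a product space\<close>

definition coord_algebra :: "'a measure \<Rightarrow> 'i set \<Rightarrow> ('i \<Rightarrow> 'a) measure" where
  "coord_algebra N J =
     vimage_algebra (space (PiM UNIV (\<lambda>_. N))) (\<lambda>\<omega>. restrict \<omega> J) (PiM J (\<lambda>_. N))"

lemma space_coord_algebra [simp]: "space (coord_algebra N J) = space (PiM UNIV (\<lambda>_. N))"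
  by (simp add: coord_algebra_def)

lemma restrict_in_space_PiM:
  "(\<lambda>\<omega>. restrict \<omega> J) \<in> space (PiM UNIV (\<lambda>_. N)) \<rightarrow> space (PiM J (\<lambda>_. N))"
  by (auto simp: space_PiM PiE_iff)

lemma measurable_coord_algebra:
  assumes "i \<in> J"
  shows "(\<lambda>\<omega>. \<omega> i) \<in> coord_algebra N J \<rightarrow>\<^sub>M N"
proof -
  have "(\<lambda>\<omega>. restrict \<omega> J i) \<in> coord_algebra N J \<rightarrow>\<^sub>M N"
    unfolding coord_algebra_def
    by (rule measurable_compose[OF measurable_vimage_algebra1[OF restrict_in_space_PiM]
          measurable_component_singleton[OF assms]])
  then show ?thesis using assms by simp
qed

lemma sets_coord_algebra:
  "sets (coord_algebra N J) =
     {(\<lambda>\<omega>. restrict \<omega> J) -` A \<inter> space (PiM UNIV (\<lambda>_. N)) | A. A \<in> sets (PiM J (\<lambda>_. N))}"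
  unfolding coord_algebra_def by (rule sets_vimage_algebra2[OF restrict_in_space_PiM])

lemma subalgebra_coord_algebra: "subalgebra (PiM UNIV (\<lambda>_. N)) (coord_algebra N J)"
proof -
  have "(\<lambda>\<omega>. restrict \<omega> J) \<in> PiM UNIV (\<lambda>_. N) \<rightarrow>\<^sub>M PiM J (\<lambda>_. N)"
    by (rule measurable_restrict_subset) simp
  then show ?thesis
    by (auto simp: subalgebra_def sets_coord_algebra intro: measurable_sets)
qed

lemma coord_algebras_indep:
  fixes N :: "'a measure" and J K :: "'i set"
  assumes N: "prob_space N" and JK: "J \<inter> K = {}"
    and A: "A \<in> sets (coord_algebra N J)" and B: "B \<in> sets (coord_algebra N K)"
  shows "measure (PiM UNIV (\<lambda>_. N)) (A \<inter> B) =
    measure (PiM UNIV (\<lambda>_. N)) A * measure (PiM UNIV (\<lambda>_. N)) B"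
proof -
  let ?M = "PiM (UNIV :: 'i set) (\<lambda>_. N)"
  interpret M: prob_space ?M by (intro prob_space_PiM N)
  have "M.indep_vars (\<lambda>_. N) (\<lambda>i \<omega>. \<omega> i) UNIV"
  proof (subst M.indep_vars_iff_distr_eq_PiM)
    have "distr ?M N (\<lambda>\<omega>. \<omega> i) = N" for i
      using distr_PiM_component[of UNIV "\<lambda>_. N" i] N by simp
    then show "distr ?M ?M (\<lambda>x. \<lambda>i\<in>UNIV. x i) = (\<Pi>\<^sub>M i\<in>UNIV. distr ?M N (\<lambda>\<omega>. \<omega> i))"
      by (simp add: restrict_UNIV distr_id)
  qed auto
  from M.indep_var_restrict[OF this JK]
  have ind: "M.indep_var (PiM J (\<lambda>_. N)) (\<lambda>\<omega>. restrict \<omega> J) (PiM K (\<lambda>_. N)) (\<lambda>\<omega>. restrict \<omega> K)"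
    by (simp add: restrict_def)
  obtain A' where A': "A' \<in> sets (PiM J (\<lambda>_. N))" "A = (\<lambda>\<omega>. restrict \<omega> J) -` A' \<inter> space ?M"
    using A by (auto simp: sets_coord_algebra)
  obtain B' where B': "B' \<in> sets (PiM K (\<lambda>_. N))" "B = (\<lambda>\<omega>. restrict \<omega> K) -` B' \<inter> space ?M"
    using B by (auto simp: sets_coord_algebra)
  have "A \<inter> B = (\<lambda>\<omega>. (restrict \<omega> J, restrict \<omega> K)) -` (A' \<times> B') \<inter> space ?M"
    using A' B' by auto
  then show ?thesis
    using M.indep_varD[OF ind A'(1) B'(1)] A' B' by simp
qed

text \<open>
  Both conditional probabilities of the problem (that of the next state given the past, and that of a
  large jump given the initial values) are of this kind: an event about later coordinates, conditioned
  on a \<open>\<sigma>\<close>-algebra of earlier ones.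
\<close>

lemma real_cond_exp_indep_coordinates:
  fixes N :: "'a measure" and J K :: "'i set"
  defines "M \<equiv> PiM (UNIV :: 'i set) (\<lambda>_. N)"
  assumes N: "prob_space N" and JK: "J \<inter> K = {}"
    and H: "subalgebra (coord_algebra N J) H" and B: "B \<in> sets (coord_algebra N K)"
  shows "AE \<omega> in M. real_cond_exp M H (indicator B) \<omega> = measure M B"
proof -
  interpret M: prob_space M unfolding M_def by (intro prob_space_PiM N)
  have sub: "subalgebra M H"
    using H subalgebra_coord_algebra[of N J] by (auto simp: subalgebra_def M_def)
  interpret finite_measure_subalgebra M H
    by standard (rule sub)
  have BM: "B \<in> sets M"
    using B subalgebra_coord_algebra[of N K] by (auto simp: subalgebra_def M_def)
  show ?thesis
  proof (rule real_cond_exp_charact)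
    fix A assume "A \<in> sets H"
    then have A: "A \<in> sets (coord_algebra N J)" and AM: "A \<in> sets M"
      using H sub by (auto simp: subalgebra_def)
    have "(\<integral>x\<in>A. indicator B x \<partial>M) = measure M (A \<inter> B)"
      using AM BM by (simp add: set_lebesgue_integral_def indicator_inter_arith[symmetric]
          Int_absorb2 sets.sets_into_space)
    also have "\<dots> = measure M A * measure M B"
      unfolding M_def by (rule coord_algebras_indep[OF N JK A B])
    also have "\<dots> = (\<integral>x\<in>A. measure M B \<partial>M)"
      using AM by (simp add: set_lebesgue_integral_def)
    finally show "(\<integral>x\<in>A. indicator B x \<partial>M) = (\<integral>x\<in>A. measure M B \<partial>M)" .
  qed (use BM in \<open>auto simp: M.emeasure_eq_measure\<close>)
qed

text \<open>
  With \<open>y = n * p\<close> the left side is at least \<open>1 - exp (-y)\<close>, and \<open>exp y \<ge> 1 + y\<close>.  The lower bound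
  \<open>x / (1 + x)\<close> covers small and large expected numbers of successes at once, and it is comparable
  to \<open>x\<close> when \<open>x\<close> stays bounded.
\<close>

lemma one_minus_power_ge:
  fixes p x :: real
  assumes "0 \<le> p" "p \<le> 1" "0 \<le> x" "x \<le> real n * p"
  shows "1 - (1 - p) ^ n \<ge> x / (1 + x)"
proof -
  have "(1 - p) ^ n \<le> exp (- p) ^ n"
    using assms exp_ge_add_one_self[of "-p"] by (intro power_mono) auto
  also have "\<dots> = inverse (exp (real n * p))"
    by (simp add: exp_minus power_inverse exp_of_nat_mult)
  also have "\<dots> \<le> inverse (1 + x)"
    using assms exp_ge_add_one_self[of "real n * p"] by (intro le_imp_inverse_le) linarith+
  finally show ?thesis
    using assms by (simp add: field_simps)
qed

lemma prob_some_coordinate: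
  fixes N :: "'a measure" and J :: "'i set"
  assumes N: "prob_space N" and J: "finite J" and T: "T \<in> sets N"
  shows "measure (PiM UNIV (\<lambda>_. N)) {\<omega> \<in> space (PiM UNIV (\<lambda>_. N)). \<exists>j\<in>J. \<omega> j \<in> T} =
    1 - (1 - measure N T) ^ card J"
proof -
  let ?M = "PiM (UNIV :: 'i set) (\<lambda>_. N)"
  interpret N: prob_space N by (rule N)
  interpret P: product_prob_space "\<lambda>_::'i. N" UNIV
    by (intro product_prob_spaceI N)
  let ?A = "{\<omega> \<in> space ?M. \<forall>j\<in>J. \<omega> j \<in> space N - T}"
  have "emeasure ?M ?A = (\<Prod>j\<in>J. emeasure N (space N - T))"
    using J T by (intro P.emeasure_PiM_Collect) auto
  also have "\<dots> = ennreal ((1 - measure N T) ^ card J)"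
    using T by (simp add: N.emeasure_eq_measure N.prob_compl ennreal_power)
  finally have A: "measure ?M ?A = (1 - measure N T) ^ card J"
    using N.prob_le_1[of T] by (intro measure_eq_emeasure_eq_ennreal) auto
  have "?A \<in> sets ?M"
    using J T by measurable
  then have "measure ?M (space ?M - ?A) = 1 - (1 - measure N T) ^ card J"
    using A by (simp add: P.prob_compl)
  moreover have "space ?M - ?A = {\<omega> \<in> space ?M. \<exists>j\<in>J. \<omega> j \<in> T}"
    by (auto simp: space_PiM PiE_iff)
  ultimately show ?thesis by simp
qed

section \<open>Kernels with constant law\<close>

context
  fixes S :: "'a measure" and \<nu> :: "'a measure"
  assumes \<nu>: "\<nu> \<in> space (prob_algebra S)"
begin

lemma bind_constant_law:
  assumes "\<mu> \<in> space (prob_algebra S)"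
  shows "bind \<mu> (\<lambda>_. \<nu>) = \<nu>"
proof -
  interpret \<mu>: prob_space \<mu> using assms by (simp add: space_prob_algebra)
  interpret \<nu>: prob_space \<nu> using \<nu> by (simp add: space_prob_algebra)
  show ?thesis
    by (intro bind_const' \<mu>.prob_space_axioms \<nu>.subprob_space_axioms)
qed

lemma kstep_constant_law:
  assumes "w \<in> space S"
  shows "kstep S (\<lambda>_. \<nu>) (Suc n) w = \<nu>"
proof (induction n)
  case 0
  have "return S w \<in> space (prob_algebra S)"
    using assms by (simp add: space_prob_algebra prob_space_return)
  then show ?case by (simp add: bind_constant_law)
next
  case (Suc n)
  then show ?case using bind_constant_law[OF \<nu>] by simp
qed

lemma irreducibility_measure_constant_law: "irreducibility_measure S (\<lambda>_. \<nu>) \<nu>"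
proof -
  interpret \<nu>: prob_space \<nu> using \<nu> by (simp add: space_prob_algebra)
  have sets: "sets \<nu> = sets S" using \<nu> by (simp add: space_prob_algebra)
  have "\<exists>n>0. measure (kstep S (\<lambda>_. \<nu>) n w) E > 0"
    if "w \<in> space S" "emeasure \<nu> E > 0" for w E
    using that kstep_constant_law[of w 0]
    by (intro exI[of _ "Suc 0"]) (simp add: \<nu>.emeasure_eq_measure)
  moreover have "emeasure \<nu> (space S) = 1"
    using \<nu>.emeasure_space_1 sets_eq_imp_space_eq[OF sets] by simp
  ultimately show ?thesis
    by (auto simp: irreducibility_measure_def sets \<nu>.sigma_finite_measure_axioms)
qed

text \<open>
  A \<open>\<nu>\<close>-null set is never entered after time \<open>0\<close>, so no irreducibility measure can charge it.
\<close>

lemma maximal_irreducibility_measure_constant_law: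
  "maximal_irreducibility_measure S (\<lambda>_. \<nu>) \<nu>"
  unfolding maximal_irreducibility_measure_def absolutely_continuous_def
proof (intro conjI allI impI subsetI irreducibility_measure_constant_law)
  interpret \<nu>: prob_space \<nu> using \<nu> by (simp add: space_prob_algebra)
  have sets: "sets \<nu> = sets S" using \<nu> by (simp add: space_prob_algebra)
  fix \<phi> E
  assume \<phi>: "irreducibility_measure S (\<lambda>_. \<nu>) \<phi>" and "E \<in> null_sets \<nu>"
  then have E: "E \<in> sets S" "measure \<nu> E = 0"
    using sets by (auto simp: null_sets_def measure_def)
  have "measure (kstep S (\<lambda>_. \<nu>) n w) E = 0" if "w \<in> space S" "n > 0" for w n
    using kstep_constant_law[OF that(1), of "n - 1"] that(2) E by simp
  moreover obtain w where "w \<in> space S"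
    using \<nu>.not_empty sets_eq_imp_space_eq[OF sets] by auto
  ultimately have "\<not> emeasure \<phi> E > 0"
    using \<phi> E unfolding irreducibility_measure_def by (metis less_irrefl)
  then show "E \<in> null_sets \<phi>"
    using \<phi> E by (auto simp: irreducibility_measure_def null_sets_def)
qed

lemma irreducible_constant_law: "irreducible_kernel S (\<lambda>_. \<nu>)"
  unfolding irreducible_kernel_def using irreducibility_measure_constant_law by blast

text \<open>
  All the states of a cyclic class move with probability one to the next class, so every class that
  follows a nonempty one has full \<open>\<nu>\<close>-measure.  Two disjoint classes cannot both have full measure.
\<close>

lemma aperiodic_constant_law: "aperiodic_kernel S (\<lambda>_. \<nu>)"
  unfolding aperiodic_kernel_def
proof (rule exI[of _ \<nu>], intro conjI allI impI)
  show "maximal_irreducibility_measure S (\<lambda>_. \<nu>) \<nu>"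
    by (rule maximal_irreducibility_measure_constant_law)
next
  interpret \<nu>: prob_space \<nu> using \<nu> by (simp add: space_prob_algebra)
  have sets: "sets \<nu> = sets S" using \<nu> by (simp add: space_prob_algebra)
  fix p D assume "kernel_cycle S (\<lambda>_. \<nu>) \<nu> p D"
  then have p: "p > 0" and D: "\<And>i. i < p \<Longrightarrow> D i \<in> sets S" and disj: "disjoint_family_on D {..<p}"
    and one: "\<And>i w. i < p \<Longrightarrow> w \<in> D i \<Longrightarrow> measure \<nu> (D (Suc i mod p)) = 1"
    and null: "emeasure \<nu> (space S - (\<Union>i<p. D i)) = 0"
    unfolding kernel_cycle_def by blast+
  have "(\<Union>i<p. D i) \<noteq> {}"
    using null \<nu>.emeasure_space_1 sets_eq_imp_space_eq[OF sets] by force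
  then obtain i0 where i0: "i0 < p" "D i0 \<noteq> {}" by auto
  have full: "measure \<nu> (D (Suc (i0 + n) mod p)) = 1" for n
  proof -
    have "D ((i0 + n) mod p) \<noteq> {}"
    proof (induction n)
      case 0 then show ?case using i0 by simp
    next
      case (Suc n)
      then have "measure \<nu> (D (Suc ((i0 + n) mod p) mod p)) = 1"
        using one[of "(i0 + n) mod p"] p by force
      then show ?case by (auto simp: mod_Suc_eq)
    qed
    then show ?thesis
      using one[of "(i0 + n) mod p"] p by (force simp: mod_Suc_eq)
  qed
  show "p = 1"
  proof (rule ccontr)
    assume "p \<noteq> 1"
    \<comment> \<open>Two consecutive classes, distinct because the cycle has length at least two.\<close>
    let ?a = "Suc (i0 + 0) mod p" and ?b = "Suc (i0 + 1) mod p"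
    have lt: "?a < p" "?b < p" using p by auto
    have "?a \<noteq> ?b"
      using p \<open>p \<noteq> 1\<close> by (simp add: mod_Suc)
    then have "D ?a \<inter> D ?b = {}"
      using disj lt unfolding disjoint_family_on_def by blast
    then have "measure \<nu> (D ?a \<union> D ?b) = 1 + 1"
      using D lt full[of 0] full[of 1] sets by (subst \<nu>.finite_measure_Union) auto
    then show False using \<nu>.prob_le_1[of "D ?a \<union> D ?b"] by linarith
  qed
qed

lemma stationary_constant_law: "stationary S (\<lambda>_. \<nu>) \<mu> \<longleftrightarrow> \<mu> = \<nu>"
  unfolding stationary_def using bind_constant_law \<nu> by metis

end

section \<open>Stochastic approximation driven by independent noise\<close>

locale iid_noise_sa =
  fixes D :: "real measure" and \<alpha>0 \<delta> c :: real
  assumes prob_D: "prob_space D" and sets_D: "sets D = sets borel"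
    and square_integrable_D: "integrable D (\<lambda>x. x\<^sup>2)" and second_moment_D: "(\<integral>x. x\<^sup>2 \<partial>D) = 1"
    and \<alpha>0_pos: "\<alpha>0 > 0" and c_pos: "c > 0"
begin

sublocale D: prob_space D by (rule prob_D)

definition m :: real where "m = (\<integral>x. x \<partial>D)"

definition law :: "vec measure" where
  "law = distr D (restrict_space borel (Rn (Suc 0))) embed"

text \<open>
  A sample path only has to carry the noise, and the iterates are computed from it.  The noise sits in
  the second component of each entry; the first one is constant.
\<close>

definition coord_law :: "(vec \<times> vec) measure" where
  "coord_law = distr D borel (\<lambda>r. (embed 0, embed r))"

definition noise :: "vec \<times> vec \<Rightarrow> real" where "noise z = snd z 0"

text \<open>
  The restoring force \<open>- x / \<alpha>0\<close> has \<open>\<zeta> = 1 / \<alpha>0\<close>, so that \<open>2 * \<zeta> * \<alpha>0 = 2 > 1\<close>, and it multiplies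
  the iterate by \<open>1 - k powr (-\<delta>) \<in> [0, 1]\<close> in step \<open>k \<ge> 1\<close>.
\<close>

definition field :: "real \<Rightarrow> real \<Rightarrow> real" where "field x w = - x / \<alpha>0 + (w - m)"

text \<open>
  The radius \<open>2 * c\<close> of the parameter set exceeds all the thresholds \<open>c * k powr (-\<beta>) \<le> c\<close>, so the
  projection cannot hide an exit.
\<close>

primrec iterate :: "nat \<Rightarrow> path \<Rightarrow> real" where
  "iterate 0 \<omega> = 0"
| "iterate (Suc k) \<omega> =
     clip (2 * c) (iterate k \<omega> + step_size \<alpha>0 \<delta> k * field (iterate k \<omega>) (noise (\<omega> k)))"

definition proc :: sa_process where
  "proc = \<lparr>pdim = Suc 0, wdim = Suc 0, params = embed ` {-(2 * c)..2 * c}, states = Rn (Suc 0),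
     field_F = (\<lambda>\<theta> w. embed (field (\<theta> 0) (w 0))), kern = (\<lambda>_ _. law),
     sample = PiM UNIV (\<lambda>_. coord_law),
     theta = (\<lambda>k \<omega>. embed (iterate k \<omega>)), chain = (\<lambda>k \<omega>. embed (noise (\<omega> k))),
     target = embed 0\<rparr>"

lemma proc_simps [simp]:
  "pdim proc = Suc 0" "wdim proc = Suc 0" "params proc = embed ` {-(2 * c)..2 * c}" "states proc = Rn (Suc 0)"
  "field_F proc \<theta> w = embed (field (\<theta> 0) (w 0))" "kern proc \<theta> w = law"
  "sample proc = PiM UNIV (\<lambda>_. coord_law)"
  "theta proc k \<omega> = embed (iterate k \<omega>)" "chain proc k \<omega> = embed (noise (\<omega> k))"
  "target proc = embed 0"
  by (simp_all add: proc_def)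

lemma kern_proc: "kern proc \<theta> = (\<lambda>_. law)"
  by (simp add: fun_eq_iff)

lemma wspace_proc [simp]: "wspace proc = restrict_space borel (Rn (Suc 0))"
  by (simp add: wspace_def)

lemma measurable_D: "(f \<in> D \<rightarrow>\<^sub>M M) = (f \<in> borel \<rightarrow>\<^sub>M M)"
  by (rule measurable_cong_sets[OF sets_D refl, THEN arg_cong, of "\<lambda>S. f \<in> S"])

lemma embed_measurable_wspace: "embed \<in> D \<rightarrow>\<^sub>M restrict_space borel (Rn (Suc 0))"
  unfolding measurable_D by (intro measurable_restrict_space2) auto

lemma law_in_prob_algebra: "law \<in> space (prob_algebra (restrict_space borel (Rn (Suc 0))))"
  unfolding law_def space_prob_algebra using D.prob_space_distr[OF embed_measurable_wspace] by simp

lemma integrable_D: "integrable D (\<lambda>x. x)"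
  by (rule D.square_integrable_imp_integrable[OF _ square_integrable_D]) (simp add: measurable_D)

lemma abs_m_le_1: "\<bar>m\<bar> \<le> 1"
proof -
  have "0 \<le> D.variance (\<lambda>x. x)" by (rule D.variance_positive)
  also have "\<dots> = 1 - m\<^sup>2"
    by (subst D.variance_eq[OF integrable_D square_integrable_D]) (simp add: second_moment_D m_def)
  finally show ?thesis by (simp add: abs_square_le_1)
qed

lemma prob_coord_law: "prob_space coord_law"
  unfolding coord_law_def by (intro D.prob_space_distr) (simp add: measurable_D borel_prod[symmetric])

lemma sets_coord_law [measurable_cong]: "sets coord_law = sets borel"
  by (simp add: coord_law_def)

lemma borel_measurable_noise [measurable]: "noise \<in> borel_measurable borel"
  unfolding noise_def[abs_def] borel_prod[symmetric] by measurable

lemma noise_measurable: "noise \<in> borel_measurable coord_law"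
  by measurable

lemma distr_noise: "distr coord_law borel noise = D"
proof -
  have "distr coord_law borel noise = distr D borel (noise \<circ> (\<lambda>r. (embed 0, embed r)))"
    unfolding coord_law_def
    by (intro distr_distr borel_measurable_noise) (simp add: measurable_D borel_prod[symmetric])
  also have "\<dots> = distr D D (\<lambda>r. r)"
    by (intro distr_cong) (auto simp: sets_D noise_def)
  finally show ?thesis by (simp add: distr_id)
qed

lemma space_sample: "space (PiM UNIV (\<lambda>_. coord_law)) = UNIV"
  by (auto simp: space_PiM PiE_iff coord_law_def)

lemma iterate_measurable:
  assumes "\<And>i. i < k \<Longrightarrow> (\<lambda>\<omega>. \<omega> i) \<in> M \<rightarrow>\<^sub>M coord_law"
  shows "iterate k \<in> borel_measurable M"
  using assms
proof (induction k)
  case 0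
  have "iterate 0 = (\<lambda>_. 0)" by (simp add: fun_eq_iff)
  then show ?case by simp
next
  case (Suc k)
  have [measurable]: "iterate k \<in> borel_measurable M"
    using Suc by simp
  have [measurable]: "(\<lambda>\<omega>. noise (\<omega> k)) \<in> borel_measurable M"
    by (rule measurable_compose[OF Suc.prems noise_measurable]) simp
  have "iterate (Suc k) = (\<lambda>\<omega>. clip (2 * c)
      (iterate k \<omega> + step_size \<alpha>0 \<delta> k * field (iterate k \<omega>) (noise (\<omega> k))))"
    by (simp add: fun_eq_iff)
  then show ?case
    by (simp add: clip_def field_def)
qed

lemma theta_measurable:
  assumes "\<And>i. i < k \<Longrightarrow> (\<lambda>\<omega>. \<omega> i) \<in> M \<rightarrow>\<^sub>M coord_law"
  shows "(\<lambda>\<omega>. embed (iterate k \<omega>)) \<in> borel_measurable M"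
  by (rule measurable_compose[OF iterate_measurable[OF assms] borel_measurable_embed])

lemma chain_measurable:
  assumes "(\<lambda>\<omega>. \<omega> k) \<in> M \<rightarrow>\<^sub>M coord_law"
  shows "(\<lambda>\<omega>. embed (noise (\<omega> k))) \<in> M \<rightarrow>\<^sub>M restrict_space borel (Rn (Suc 0))"
proof (rule measurable_restrict_space2)
  show "(\<lambda>\<omega>. embed (noise (\<omega> k))) \<in> borel_measurable M"
    by (rule measurable_compose[OF measurable_compose[OF assms noise_measurable] borel_measurable_embed])
qed simp

lemma coord_measurable: "(\<lambda>\<omega>. \<omega> k) \<in> PiM UNIV (\<lambda>_::nat. coord_law) \<rightarrow>\<^sub>M coord_law"
  by (rule measurable_component_singleton) simp

lemma iterate_bounded: "iterate k \<omega> \<in> {-(2 * c)..2 * c}"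
  using c_pos by (cases k) (auto simp: clip_def)

lemma history_subalgebra: "subalgebra (coord_algebra coord_law {..k}) (history proc k)"
proof -
  have "(\<lambda>\<omega>. (theta proc j \<omega>, chain proc j \<omega>)) -` A \<inter> space (sample proc)
      \<in> sets (coord_algebra coord_law {..k})" if "j \<le> k" "A \<in> sets borel" for j A
  proof -
    have "(\<lambda>\<omega>. \<omega> i) \<in> coord_algebra coord_law {..k} \<rightarrow>\<^sub>M coord_law" if "i \<le> k" for i
      using that by (intro measurable_coord_algebra) simp
    then have "(\<lambda>\<omega>. embed (iterate j \<omega>)) \<in> borel_measurable (coord_algebra coord_law {..k})"
      "(\<lambda>\<omega>. embed (noise (\<omega> j))) \<in> borel_measurable (coord_algebra coord_law {..k})"
      using that(1)
      by (auto intro!: theta_measurable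
          measurable_restrict_space2_iff[THEN iffD1, THEN conjunct1, OF chain_measurable])
    then have "(\<lambda>\<omega>. (theta proc j \<omega>, chain proc j \<omega>))
        \<in> borel_measurable (coord_algebra coord_law {..k})"
      unfolding proc_simps borel_prod[symmetric] by (rule measurable_Pair)
    from measurable_sets[OF this that(2)] show ?thesis
      by simp
  qed
  then have gens: "{(\<lambda>\<omega>. (theta proc j \<omega>, chain proc j \<omega>)) -` A \<inter> space (sample proc) | j A.
      j \<le> k \<and> A \<in> sets borel} \<subseteq> sets (coord_algebra coord_law {..k})"
    by blast
  have space: "space (sample proc) = space (coord_algebra coord_law {..k})" by simp
  show ?thesis
    unfolding subalgebra_def history_def
    using sets.sigma_sets_subset[OF gens] sets.space_closed[of "coord_algebra coord_law {..k}"] gens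
    by (simp only: space space_measure_of_conv sets_measure_of subset_trans simp_thms)
qed

lemma sa_model_proc: "sa_model proc"
proof -
  have [measurable]: "(\<lambda>p::vec \<times> vec. fst p 0) \<in> borel_measurable borel"
    "(\<lambda>p::vec \<times> vec. snd p 0) \<in> borel_measurable borel"
    unfolding borel_prod[symmetric] by measurable
  have "(\<lambda>p. embed (field (fst p 0) (snd p 0))) \<in> borel_measurable (borel :: (vec \<times> vec) measure)"
    unfolding field_def by measurable
  then show ?thesis
    unfolding sa_model_def using law_in_prob_algebra
    by (auto simp: case_prod_beta' intro!: measurable_restrict_space1)
qed

lemma distr_chain:
  fixes k :: nat
  shows "distr (PiM UNIV (\<lambda>_. coord_law)) (restrict_space borel (Rn (Suc 0))) (\<lambda>\<omega>. embed (noise (\<omega> k))) = law"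
proof -
  have emb: "embed \<in> borel \<rightarrow>\<^sub>M restrict_space borel (Rn (Suc 0))"
    using embed_measurable_wspace by (simp add: measurable_D)
  have "law = distr (distr (distr (PiM UNIV (\<lambda>_. coord_law)) coord_law (\<lambda>\<omega>. \<omega> k)) borel noise)
      (restrict_space borel (Rn (Suc 0))) embed"
    using distr_PiM_component[of UNIV "\<lambda>_. coord_law" k] prob_coord_law
    by (simp add: distr_noise law_def)
  also have "\<dots> = distr (PiM UNIV (\<lambda>_. coord_law)) (restrict_space borel (Rn (Suc 0))) (embed \<circ> (noise \<circ> (\<lambda>\<omega>. \<omega> k)))"
    unfolding distr_distr[OF noise_measurable coord_measurable]
    by (rule distr_distr[OF emb]) (simp add: o_def measurable_compose[OF coord_measurable noise_measurable])
  finally show ?thesis by (simp add: o_def)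
qed

lemma sa_recursion_proc: "sa_recursion \<alpha>0 \<delta> proc"
  unfolding sa_recursion_def
proof (intro conjI allI ballI)
  show "prob_space (sample proc)"
    using prob_coord_law by (auto intro: prob_space_PiM)
  show "theta proc k \<in> sample proc \<rightarrow>\<^sub>M restrict_space borel (params proc)" for k
  proof (rule measurable_restrict_space2)
    show "theta proc k \<in> space (sample proc) \<rightarrow> params proc"
      using iterate_bounded by auto
    have "theta proc k = (\<lambda>\<omega>. embed (iterate k \<omega>))" by (simp add: fun_eq_iff)
    then show "theta proc k \<in> sample proc \<rightarrow>\<^sub>M borel"
      using theta_measurable[OF coord_measurable] by simp
  qed
  show "chain proc k \<in> sample proc \<rightarrow>\<^sub>M wspace proc" for k
  proof -
    have "chain proc k = (\<lambda>\<omega>. embed (noise (\<omega> k)))" by (simp add: fun_eq_iff)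
    then show ?thesis using chain_measurable[OF coord_measurable] by simp
  qed
  show "AE \<omega> in sample proc. theta proc (Suc k) \<omega> =
      eproj (pdim proc) (params proc) (\<lambda>i. theta proc k \<omega> i +
        step_size \<alpha>0 \<delta> k * field_F proc (theta proc k \<omega>) (chain proc k \<omega>) i)" for k
    using c_pos by (simp add: eproj_embed_interval del: atLeastAtMost_iff)
  fix k E assume E: "E \<in> sets (wspace proc)"
  let ?B = "{\<omega> \<in> space (sample proc). chain proc (Suc k) \<omega> \<in> E}"
  have "(\<lambda>\<omega>. \<omega> (Suc k)) \<in> coord_algebra coord_law {k<..} \<rightarrow>\<^sub>M coord_law"
    by (rule measurable_coord_algebra) simp
  then have "(\<lambda>\<omega>. embed (noise (\<omega> (Suc k))))
      \<in> coord_algebra coord_law {k<..} \<rightarrow>\<^sub>M restrict_space borel (Rn (Suc 0))"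
    by (rule chain_measurable)
  from measurable_sets[OF this, of E]
  have B: "?B \<in> sets (coord_algebra coord_law {k<..})"
    using E by (simp add: space_sample vimage_def)
  have "measure (sample proc) ?B = measure law E"
    using E by (subst distr_chain[of "Suc k", symmetric], subst measure_distr[OF chain_measurable[OF coord_measurable]])
      (auto intro!: arg_cong[where f = "measure _"])
  moreover have "AE \<omega> in sample proc.
      real_cond_exp (sample proc) (history proc k) (indicator ?B) \<omega> = measure (sample proc) ?B"
    unfolding proc_simps(7)
    by (rule real_cond_exp_indep_coordinates[OF prob_coord_law _ history_subalgebra])
      (use B in auto)
  ultimately show "AE \<omega> in sample proc.
      real_cond_exp (sample proc) (history proc k) (indicator ?B) \<omega>
        = measure (kern proc (theta proc k \<omega>) (chain proc k \<omega>)) E"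
    by simp
qed

lemma compactness_proc: "compactness proc"
  unfolding compactness_def using c_pos
  by (auto simp: compactin_embed_interval econvex_embed_interval)

lemma nn_integral_U2: "(\<integral>\<^sup>+y. ennreal (U proc 2 y) \<partial>law) = 2"
proof -
  have "(\<integral>\<^sup>+y. ennreal (U proc 2 y) \<partial>law) = (\<integral>\<^sup>+r. ennreal (1 + r\<^sup>2) \<partial>D)"
    unfolding law_def
  proof (subst nn_integral_distr[OF embed_measurable_wspace])
    show "(\<lambda>y. ennreal (U proc 2 y)) \<in> borel_measurable (distr D (restrict_space borel (Rn (Suc 0))) embed)"
      unfolding U_def by (simp add: measurable_restrict_space1)
  qed (simp add: U_def)
  also have "\<dots> = ennreal (\<integral>r. 1 + r\<^sup>2 \<partial>D)"
    using square_integrable_D by (intro nn_integral_eq_integral) auto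
  also have "\<dots> = 2"
    using square_integrable_D second_moment_D by (simp add: D.prob_space)
  finally show ?thesis .
qed

text \<open>
  All transitions draw from one law, so the whole state space is a small set with \<open>N = 1\<close> and
  \<open>\<epsilon>0 = 1\<close>.  Hence the drift condition with \<open>\<lambda> = 0\<close> only asks for a bound on the second moment of
  that law: \<open>b = 2\<close> is the mean of \<open>1 + w\<^sup>2\<close>.
\<close>

lemma ergodicity_proc: "ergodicity 1 1 0 2 proc"
  unfolding ergodicity_def
proof (intro conjI ballI)
  show "irreducible_kernel (wspace proc) (kern proc \<theta>)" "aperiodic_kernel (wspace proc) (kern proc \<theta>)" for \<theta>
    using irreducible_constant_law[OF law_in_prob_algebra] aperiodic_constant_law[OF law_in_prob_algebra]
    by (simp_all add: kern_proc)
  have "Rn (Suc 0) \<noteq> {}" using embed_in_Rn by blast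
  moreover have "measure (kstep (wspace proc) (kern proc \<theta>) 1 w) E = measure law E"
    if "w \<in> Rn (Suc 0)" for \<theta> w E
    using kstep_constant_law[OF law_in_prob_algebra, of w 0] that by (simp add: kern_proc space_restrict_space)
  ultimately show "\<exists>W0 \<phi>. W0 \<in> sets (wspace proc) \<and> W0 \<noteq> {} \<and> \<phi> \<in> space (prob_algebra (wspace proc)) \<and>
      (\<forall>\<theta>\<in>params proc. \<forall>w\<in>W0. \<forall>E\<in>sets (wspace proc).
           1 * measure \<phi> E \<le> measure (kstep (wspace proc) (kern proc \<theta>) 1 w) E) \<and>
      (\<forall>\<theta>\<in>params proc. \<forall>w\<in>states proc.
           (\<integral>\<^sup>+ y. ennreal (U proc 2 y) \<partial>kern proc \<theta> w) \<le> ennreal (0 * U proc 2 w + 2 * indicator W0 w))"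
    using law_in_prob_algebra
    by (intro exI[of _ "Rn (Suc 0)"] exI[of _ law] conjI)
      (simp_all add: nn_integral_U2 sets_restrict_space_iff)
  show "integrable (sample proc) (\<lambda>\<omega>. U proc 2 (chain proc 0 \<omega>))"
  proof -
    have meas: "U proc 2 \<in> borel_measurable (restrict_space borel (Rn (Suc 0)))"
      unfolding U_def[abs_def] by (simp add: measurable_restrict_space1)
    have "integrable law (U proc 2)"
      by (rule integrableI_nn_integral_finite[where x = 2])
        (use meas in \<open>auto simp: law_def U_def nn_integral_U2[unfolded law_def U_def, simplified]\<close>)
    then have "integrable (distr (PiM UNIV (\<lambda>_::nat. coord_law)) (restrict_space borel (Rn (Suc 0)))
        (\<lambda>\<omega>. embed (noise (\<omega> 0)))) (U proc 2)"
      by (simp only: distr_chain)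
    then show ?thesis
      using integrable_distr[OF chain_measurable[OF coord_measurable]] by simp
  qed
qed auto

lemma mean_field_proc: "mean_field proc \<theta> = embed (- \<theta> 0 / \<alpha>0)"
proof -
  have "stat_dist proc \<theta> = law"
    unfolding stat_dist_def
    by (rule the_equality) (simp_all add: kern_proc stationary_constant_law[OF law_in_prob_algebra])
  moreover have "(\<integral>w. embed (field (\<theta> 0) (w 0)) i \<partial>law) = embed (- \<theta> 0 / \<alpha>0) i" for i
  proof (cases "i = 0")
    case True
    have "(\<integral>w. field (\<theta> 0) (w 0) \<partial>law) = (\<integral>r. field (\<theta> 0) (embed r 0) \<partial>D)"
      unfolding law_def field_def
      by (rule integral_distr[OF embed_measurable_wspace]) (simp add: measurable_restrict_space1)
    also have "\<dots> = - \<theta> 0 / \<alpha>0"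
      using integrable_D by (simp add: field_def D.prob_space m_def)
    finally show ?thesis using True by simp
  qed (simp add: embed_def)
  ultimately show ?thesis by (simp add: mean_field_def fun_eq_iff)
qed

lemma kernel_continuity_proc: "kernel_continuity 1 proc"
  by (auto simp: kernel_continuity_def U_def)

lemma growth_proc: "growth (1 / \<alpha>0) (2 * c / \<alpha>0 + 1) proc"
  unfolding growth_def
proof (intro conjI ballI)
  fix \<theta> \<theta>' w :: vec
  have "\<bar>field (\<theta> 0) (w 0) - field (\<theta>' 0) (w 0)\<bar> = 1 / \<alpha>0 * \<bar>\<theta> 0 - \<theta>' 0\<bar>"
    using \<alpha>0_pos by (simp add: field_def diff_divide_distrib[symmetric] abs_minus_commute)
  also have "\<dots> \<le> 1 / \<alpha>0 * (1 + \<bar>w 0\<bar>) * \<bar>\<theta> 0 - \<theta>' 0\<bar>"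
    using \<alpha>0_pos by (intro mult_right_mono) (auto simp: field_simps)
  finally show "edist (pdim proc) (field_F proc \<theta> w) (field_F proc \<theta>' w)
      \<le> 1 / \<alpha>0 * (1 + enorm (wdim proc) w) * edist (pdim proc) \<theta> \<theta>'"
    by simp
next
  fix \<theta> w :: vec assume "\<theta> \<in> params proc"
  then have "\<bar>\<theta> 0\<bar> \<le> 2 * c" by auto
  then have "\<bar>\<theta> 0 / \<alpha>0\<bar> \<le> 2 * c / \<alpha>0"
    using \<alpha>0_pos by (simp add: divide_right_mono)
  then have "\<bar>field (\<theta> 0) (w 0)\<bar> \<le> 2 * c / \<alpha>0 + \<bar>w 0\<bar> + 1"
    using abs_m_le_1 unfolding field_def by linarith
  also have "\<dots> \<le> (2 * c / \<alpha>0 + 1) * (1 + \<bar>w 0\<bar>)"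
  proof -
    have "0 \<le> 2 * c / \<alpha>0 * \<bar>w 0\<bar>" using c_pos \<alpha>0_pos by simp
    then show ?thesis by (simp add: distrib_left distrib_right del: zero_le_mult_iff)
  qed
  finally show "enorm (pdim proc) (field_F proc \<theta> w) \<le> (2 * c / \<alpha>0 + 1) * (1 + enorm (wdim proc) w)"
    by simp
qed (use \<alpha>0_pos c_pos in \<open>auto intro!: add_pos_pos\<close>)

lemma sa_conditions_proc:
  "sa_conditions \<alpha>0 \<delta> 1 1 0 2 1 (1 / \<alpha>0) (2 * c / \<alpha>0 + 1) (1 / \<alpha>0) proc"
proof -
  have "interior_target proc"
    using interior_embed_interval[of "-(2 * c)" 0 "2 * c"] c_pos
    by (simp add: interior_target_def mean_field_proc embed_def)
  moreover have "quasi_strong_monotonicity (1 / \<alpha>0) proc"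
    using \<alpha>0_pos by (simp add: quasi_strong_monotonicity_def mean_field_proc power2_eq_square)
  ultimately show ?thesis
    unfolding sa_conditions_def
    using sa_model_proc sa_recursion_proc compactness_proc ergodicity_proc kernel_continuity_proc
      growth_proc \<alpha>0_pos by simp
qed

section \<open>Exits forced by one large noise value\<close>

text \<open>
  If the iterate at time \<open>k\<close> is still within \<open>c * k powr (-\<beta>)\<close> of the target, a jump which moves it by
  \<open>3 * c * k powr (-\<beta>)\<close> leaves it at distance at least \<open>2 * c * k powr (-\<beta>)\<close>, even after the
  contraction and the projection.  So one large noise value forces an exit at time \<open>k\<close> or
  \<open>Suc k\<close>, without any control on the rest of the path.  The jump level is uniform over
  \<open>k0 \<le> k < 2 * k0\<close>: the factor \<open>2 powr (\<delta> - \<beta>)\<close> pays for \<open>k\<close> instead of \<open>k0\<close>, and the summand \<open>1\<close> for the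
  centring \<open>m\<close>.
\<close>

lemma jump_exits:
  assumes \<delta>: "0 \<le> \<beta>" "\<beta> < \<delta>" and k0: "k0 > 0" and k: "k0 \<le> k" "k < 2 * k0"
    and jump: "noise (\<omega> k) \<ge> (1 + 3 * c / \<alpha>0 * 2 powr (\<delta> - \<beta>)) * real k0 powr (\<delta> - \<beta>)"
  shows "\<omega> \<in> exit_event proc c \<beta> k0"
proof -
  have kpos: "k > 0" using k k0 by simp
  define y where "y = iterate k \<omega> + step_size \<alpha>0 \<delta> k * field (iterate k \<omega>) (noise (\<omega> k))"
  have next_it: "iterate (Suc k) \<omega> = clip (2 * c) y" by (simp add: y_def)
  have exit: "\<omega> \<in> exit_event proc c \<beta> k0"
    if "j \<ge> k0" "\<bar>iterate j \<omega>\<bar> > c * real j powr (-\<beta>)" for j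
    using that by (auto simp: exit_event_def space_sample)
  show ?thesis
  proof (cases "\<bar>iterate k \<omega>\<bar> > c * real k powr (-\<beta>)")
    case True then show ?thesis using exit k by blast
  next
    case False
    have ak: "step_size \<alpha>0 \<delta> k = \<alpha>0 * real k powr (-\<delta>)"
      using kpos by (simp add: step_size_def)
    have y: "y = (1 - real k powr (-\<delta>)) * iterate k \<omega> + \<alpha>0 * real k powr (-\<delta>) * (noise (\<omega> k) - m)"
      using \<alpha>0_pos by (simp add: y_def ak field_def field_simps)
    have kd: "0 < real k powr (-\<delta>)" "real k powr (-\<delta>) \<le> 1"
      using kpos \<delta> by (auto simp: powr_le_one_le powr_minus intro!: inverse_le_1_iff[THEN iffD2] ge_one_powr_ge_zero)
    have "real k powr (\<delta> - \<beta>) \<le> (2 * real k0) powr (\<delta> - \<beta>)"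
      using k \<delta> by (intro powr_mono2) auto
    then have "3 * c / \<alpha>0 * real k powr (\<delta> - \<beta>) \<le> 3 * c / \<alpha>0 * (2 powr (\<delta> - \<beta>) * real k0 powr (\<delta> - \<beta>))"
      using c_pos \<alpha>0_pos by (intro mult_left_mono) (auto simp: powr_mult)
    moreover have "1 \<le> real k0 powr (\<delta> - \<beta>)"
      using k0 \<delta> by (intro ge_one_powr_ge_zero) auto
    ultimately have "3 * c / \<alpha>0 * real k powr (\<delta> - \<beta>) + m \<le> noise (\<omega> k)"
      using jump abs_m_le_1 by (simp add: algebra_simps)
    then have "\<alpha>0 * real k powr (-\<delta>) * (3 * c / \<alpha>0 * real k powr (\<delta> - \<beta>))
        \<le> \<alpha>0 * real k powr (-\<delta>) * (noise (\<omega> k) - m)"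
      using \<alpha>0_pos kd by (intro mult_left_mono) auto
    moreover have "\<alpha>0 * real k powr (-\<delta>) * (3 * c / \<alpha>0 * real k powr (\<delta> - \<beta>)) = 3 * c * real k powr (-\<beta>)"
      using \<alpha>0_pos by (simp add: powr_add[symmetric])
    ultimately have jump': "3 * c * real k powr (-\<beta>) \<le> \<alpha>0 * real k powr (-\<delta>) * (noise (\<omega> k) - m)"
      by simp
    have "\<bar>(1 - real k powr (-\<delta>)) * iterate k \<omega>\<bar> \<le> 1 * \<bar>iterate k \<omega>\<bar>"
      unfolding abs_mult using kd by (intro mult_right_mono) auto
    then have "y \<ge> 2 * c * real k powr (-\<beta>)"
      using False jump' unfolding y by linarith
    moreover have "real k powr (-\<beta>) \<le> 1"
      using kpos \<delta> by (auto simp: powr_minus intro!: inverse_le_1_iff[THEN iffD2] ge_one_powr_ge_zero)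
    then have "2 * c * real k powr (-\<beta>) \<le> 2 * c" using c_pos by simp
    ultimately have "2 * c * real k powr (-\<beta>) \<le> iterate (Suc k) \<omega>"
      unfolding next_it clip_def by linarith
    moreover have "real (Suc k) powr (-\<beta>) \<le> real k powr (-\<beta>)"
      using kpos \<delta> by (intro powr_mono2') auto
    then have "c * real (Suc k) powr (-\<beta>) \<le> c * real k powr (-\<beta>)"
      using c_pos by simp
    moreover have "0 < c * real k powr (-\<beta>)" using c_pos kpos by simp
    ultimately have "\<bar>iterate (Suc k) \<omega>\<bar> > c * real (Suc k) powr (-\<beta>)"
      by linarith
    then show ?thesis using exit[of "Suc k"] k by simp
  qed
qed

lemma exit_event_measurable: "exit_event proc c \<beta> k0 \<in> sets (PiM UNIV (\<lambda>_. coord_law))"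
proof -
  have [measurable]: "iterate k \<in> borel_measurable (PiM UNIV (\<lambda>_. coord_law))" for k
    by (rule iterate_measurable) simp
  have "exit_event proc c \<beta> k0 = {\<omega> \<in> space (PiM UNIV (\<lambda>_. coord_law)).
      \<exists>k\<in>{k0..}. \<bar>iterate k \<omega>\<bar> > c * real k powr (-\<beta>)}"
    by (auto simp: exit_event_def)
  also have "\<dots> \<in> sets (PiM UNIV (\<lambda>_. coord_law))"
    by measurable
  finally show ?thesis .
qed

text \<open>
  The noise values at the \<open>k0\<close> times from \<open>k0\<close> to \<open>2 * k0 - 1\<close> are independent of one another and, as
  \<open>k0 > 0\<close>, of the initial values.
\<close>

lemma cond_exit_prob_ge:
  assumes \<delta>: "0 \<le> \<beta>" "\<beta> < \<delta>" and k0: "k0 > 0"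
    and x: "0 \<le> x"
      "x \<le> real k0 * measure D {(1 + 3 * c / \<alpha>0 * 2 powr (\<delta> - \<beta>)) * real k0 powr (\<delta> - \<beta>)..}"
  shows "AE \<omega> in sample proc.
    real_cond_exp (sample proc) (history proc 0) (indicator (exit_event proc c \<beta> k0)) \<omega> \<ge> x / (1 + x)"
proof -
  define t where "t = (1 + 3 * c / \<alpha>0 * 2 powr (\<delta> - \<beta>)) * real k0 powr (\<delta> - \<beta>)"
  define T where "T = noise -` {t..} \<inter> space coord_law"
  let ?M = "PiM UNIV (\<lambda>_::nat. coord_law)"
  define B where "B = {\<omega> \<in> space ?M. \<exists>j\<in>{k0..<2 * k0}. \<omega> j \<in> T}"
  interpret M: prob_space ?M
    using prob_coord_law by (intro prob_space_PiM)
  have T: "T \<in> sets coord_law"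
    unfolding T_def using noise_measurable by (rule measurable_sets) simp
  have "measure coord_law T = measure D {t..}"
    unfolding T_def by (subst distr_noise[symmetric], subst measure_distr[OF noise_measurable]) auto
  then have "measure ?M B = 1 - (1 - measure D {t..}) ^ k0"
    using prob_some_coordinate[OF prob_coord_law _ T, of "{k0..<2 * k0}"] by (simp add: B_def)
  then have prob: "measure ?M B \<ge> x / (1 + x)"
    using one_minus_power_ge[of "measure D {t..}" x k0] x unfolding t_def by simp
  have "{\<omega> \<in> space (coord_algebra coord_law {0<..}). \<exists>j\<in>{k0..<2 * k0}. \<omega> j \<in> T}
      \<in> sets (coord_algebra coord_law {0<..})"
  proof (intro sets.sets_Collect_finite_Ex)
    fix j assume "j \<in> {k0..<2 * k0}"
    then have "(\<lambda>\<omega>. \<omega> j) \<in> coord_algebra coord_law {0<..} \<rightarrow>\<^sub>M coord_law"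
      using k0 by (intro measurable_coord_algebra) auto
    from measurable_sets[OF this T]
    show "{\<omega> \<in> space (coord_algebra coord_law {0<..}). \<omega> j \<in> T} \<in> sets (coord_algebra coord_law {0<..})"
      by (simp add: vimage_def Int_def conj_commute)
  qed simp
  then have B: "B \<in> sets (coord_algebra coord_law {0<..})"
    by (simp add: B_def)
  have BM: "B \<in> sets ?M"
    using B subalgebra_coord_algebra by (auto simp: subalgebra_def)
  have sub: "B \<subseteq> exit_event proc c \<beta> k0"
    unfolding B_def T_def t_def using jump_exits[OF \<delta> k0] by auto
  have hist: "subalgebra ?M (history proc 0)"
    using history_subalgebra[of 0] subalgebra_coord_algebra[of coord_law "{..0::nat}"]
    by (auto simp: subalgebra_def)
  interpret finite_measure_subalgebra ?M "history proc 0"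
    by standard (rule hist)
  have "AE \<omega> in ?M. real_cond_exp ?M (history proc 0) (indicator B) \<omega>
      \<le> real_cond_exp ?M (history proc 0) (indicator (exit_event proc c \<beta> k0)) \<omega>"
    using sub BM exit_event_measurable
    by (intro real_cond_exp_mono) (auto simp: indicator_def M.emeasure_eq_measure)
  moreover have "AE \<omega> in ?M. real_cond_exp ?M (history proc 0) (indicator B) \<omega> = measure ?M B"
    by (rule real_cond_exp_indep_coordinates[OF prob_coord_law _ history_subalgebra B]) auto
  ultimately show ?thesis
    unfolding proc_simps(7) by eventually_elim (use prob in simp)
qed

text \<open>
  A tail of order \<open>t powr (-(2 + \<epsilon>))\<close> at the jump level \<open>k0 powr (\<delta> - \<beta>)\<close>, taken \<open>k0\<close> times, gives the
  exponent \<open>1 - (2 + \<epsilon>) * (\<delta> - \<beta>)\<close>.  This is at least \<open>-(2 * (\<delta> - \<beta>) - 1 + \<epsilon>)\<close> because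
  \<open>\<delta> - \<beta> \<le> 1\<close>, and it is nonpositive because \<open>\<delta> - \<beta> > 1 / 2\<close>.  So this lower bound \<open>x\<close> for the
  expected number of jumps stays bounded, and \<open>x / (1 + x)\<close> is of the order of \<open>x\<close>.
\<close>

lemma polynomial_cond_exit_prob:
  assumes \<delta>: "0 \<le> \<beta>" "\<beta> < \<delta> - 1 / 2" "\<delta> \<le> 1" and \<epsilon>: "\<epsilon> > 0"
    and \<kappa>: "\<kappa> > 0" "\<And>t. t \<ge> 1 \<Longrightarrow> measure D {t..} \<ge> \<kappa> * t powr (-(2 + \<epsilon>))"
  shows "\<exists>C>0. \<exists>K>0. \<forall>k0::nat. real k0 \<ge> K \<longrightarrow>
    (AE \<omega> in sample proc.
      real_cond_exp (sample proc) (history proc 0) (indicator (exit_event proc c \<beta> k0)) \<omega>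
        \<ge> C * real k0 powr (- (2 * (\<delta> - \<beta>) - 1 + \<epsilon>)))"
proof -
  define A where "A = 1 + 3 * c / \<alpha>0 * 2 powr (\<delta> - \<beta>)"
  define L where "L = \<kappa> * A powr (-(2 + \<epsilon>))"
  have A: "A \<ge> 1" using c_pos \<alpha>0_pos by (simp add: A_def)
  then have L: "L > 0" using \<kappa> by (simp add: L_def)
  define \<rho> where "\<rho> = (2 + \<epsilon>) * (\<delta> - \<beta>) - 1"
  have "\<rho> = (2 * (\<delta> - \<beta>) - 1) + \<epsilon> * (\<delta> - \<beta>)" by (simp add: \<rho>_def algebra_simps)
  moreover have "0 \<le> \<epsilon> * (\<delta> - \<beta>)" "\<epsilon> * (\<delta> - \<beta>) \<le> \<epsilon> * 1"
    using \<delta> \<epsilon> by (intro mult_nonneg_nonneg mult_left_mono; simp)+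
  ultimately have \<rho>: "0 \<le> \<rho>" "\<rho> \<le> 2 * (\<delta> - \<beta>) - 1 + \<epsilon>"
    using \<delta> by auto
  have main: "AE \<omega> in sample proc.
      real_cond_exp (sample proc) (history proc 0) (indicator (exit_event proc c \<beta> k0)) \<omega>
        \<ge> L / (1 + L) * real k0 powr (- (2 * (\<delta> - \<beta>) - 1 + \<epsilon>))" if "real k0 \<ge> 1" for k0 :: nat
  proof -
    define x where "x = L * real k0 powr (-\<rho>)"
    have tail: "1 \<le> A * real k0 powr (\<delta> - \<beta>)"
      using A that \<delta> by (intro mult_ge1_I ge_one_powr_ge_zero) auto
    have "x = real k0 * (\<kappa> * (A * real k0 powr (\<delta> - \<beta>)) powr (-(2 + \<epsilon>)))"
    proof -
      have "(A * real k0 powr (\<delta> - \<beta>)) powr (-(2 + \<epsilon>)) =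
          A powr (-(2 + \<epsilon>)) * real k0 powr (-(2 + \<epsilon>) * (\<delta> - \<beta>))"
        using A by (simp add: powr_mult powr_powr mult.commute)
      moreover have "real k0 powr (-\<rho>) = real k0 powr 1 * real k0 powr (-(2 + \<epsilon>) * (\<delta> - \<beta>))"
        unfolding powr_add[symmetric] by (simp add: \<rho>_def algebra_simps)
      ultimately show ?thesis using that by (simp add: x_def L_def)
    qed
    also have "\<dots> \<le> real k0 * measure D {A * real k0 powr (\<delta> - \<beta>)..}"
      using \<kappa>(2)[OF tail] by (intro mult_left_mono) auto
    finally have x: "x \<le> real k0 * measure D {A * real k0 powr (\<delta> - \<beta>)..}" .
    have x0: "0 \<le> x" "x \<le> L"
    proof -
      have "real k0 powr (-\<rho>) \<le> 1"
        using that \<rho> by (auto simp: powr_minus intro!: inverse_le_1_iff[THEN iffD2] ge_one_powr_ge_zero)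
      then show "x \<le> L" using L by (simp add: x_def)
      show "0 \<le> x" using L by (simp add: x_def)
    qed
    have "L / (1 + L) * real k0 powr (- (2 * (\<delta> - \<beta>) - 1 + \<epsilon>)) \<le> L / (1 + L) * real k0 powr (-\<rho>)"
      using that \<rho> L by (intro mult_left_mono powr_mono) auto
    also have "\<dots> = x / (1 + L)" by (simp add: x_def)
    also have "\<dots> \<le> x / (1 + x)" using x0 by (intro divide_left_mono) auto
    finally have le: "L / (1 + L) * real k0 powr (- (2 * (\<delta> - \<beta>) - 1 + \<epsilon>)) \<le> x / (1 + x)" .
    have "AE \<omega> in sample proc.
        real_cond_exp (sample proc) (history proc 0) (indicator (exit_event proc c \<beta> k0)) \<omega> \<ge> x / (1 + x)"
      using x that \<delta> unfolding A_def by (intro cond_exit_prob_ge x0) auto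
    then show ?thesis
      by (rule eventually_mono) (rule order_trans[OF le])
  qed
  show ?thesis
    by (rule exI[of _ "L / (1 + L)"], rule conjI, use L in simp, rule exI[of _ 1]) (use main in simp)
qed

end

section \<open>Polynomial lower bound for the exit probability\<close>

theorem theorem2:
  fixes \<delta> \<alpha>0 \<beta> c :: real
  assumes "1/2 < \<delta>" and "\<delta> \<le> 1" and "0 < \<alpha>0" and "0 \<le> \<beta>" and "\<beta> < \<delta> - 1/2" and "0 < c"
  shows "\<exists>(N::nat) \<epsilon>0 l b LP LF CF \<zeta>. \<exists>\<C> :: sa_process set.
    (\<forall>p\<in>\<C>. sa_conditions \<alpha>0 \<delta> N \<epsilon>0 l b LP LF CF \<zeta> p) \<and>
    (\<forall>\<epsilon>>0. \<exists>p\<in>\<C>. \<exists>C>0. \<exists>K>0. \<forall>k0::nat. real k0 \<ge> K \<longrightarrow>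
       (AE \<omega> in sample p.
          real_cond_exp (sample p) (history p 0) (indicator (exit_event p c \<beta> k0)) \<omega>
            \<ge> C * real k0 powr (- (2 * (\<delta> - \<beta>) - 1 + \<epsilon>))))"
proof -
  define \<C> where "\<C> = {p. sa_conditions \<alpha>0 \<delta> 1 1 0 2 1 (1 / \<alpha>0) (2 * c / \<alpha>0 + 1) (1 / \<alpha>0) p}"
  have "\<exists>p\<in>\<C>. \<exists>C>0. \<exists>K>0. \<forall>k0::nat. real k0 \<ge> K \<longrightarrow>
       (AE \<omega> in sample p.
          real_cond_exp (sample p) (history p 0) (indicator (exit_event p c \<beta> k0)) \<omega>
            \<ge> C * real k0 powr (- (2 * (\<delta> - \<beta>) - 1 + \<epsilon>)))" if "\<epsilon> > 0" for \<epsilon>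
  proof -
    obtain D \<kappa> where D: "prob_space D" "sets D = sets borel" "integrable D (\<lambda>x. x\<^sup>2)" "(\<integral>x. x\<^sup>2 \<partial>D) = 1"
      and \<kappa>: "\<kappa> > 0" "\<And>t. t \<ge> 1 \<Longrightarrow> measure D {t..} \<ge> \<kappa> * t powr (-(2 + \<epsilon>))"
      using heavy_tailed_law[OF \<open>\<epsilon> > 0\<close>] by blast
    interpret iid_noise_sa D \<alpha>0 \<delta> c
      by (rule iid_noise_sa.intro) (fact D assms)+
    have "proc \<in> \<C>" unfolding \<C>_def using sa_conditions_proc by simp
    then show ?thesis
      using polynomial_cond_exit_prob[OF assms(4,5,2) \<open>\<epsilon> > 0\<close> \<kappa>] by (rule bexI[rotated])
  qed
  then show ?thesis unfolding \<C>_def by blast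
qed

end
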